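(* Let $\epsilon>0$, let $d'\ge 1$ be an integer, and let $\zeta=\max\{1,\min\{d',\lfloor \epsilon/2.5\rfloor\}\}$. Consider inputs $\mathbf{x}=\mathbf{x}_{(1)}\oplus\mathbf{x}_{(2)}\oplus\cdots\oplus\mathbf{x}_{(d')}$ consisting of $d'$ features, where for each index $i$ it is fixed in advance whether feature $i$ is numerical (so $\mathbf{x}_{(i)}\in[-1,1]$) or categorical (so $\mathbf{x}_{(i)}$ is a one-hot vector of some fixed length $k_i$). Consider the following randomized algorithm with input $\mathbf{x}$. 1. Initialize $\widehat{\mathbf{x}}=\widehat{\mathbf{x}}_{(1)}\oplus\cdots\oplus\widehat{\mathbf{x}}_{(d')}$ to be the zero vector. 2. Draw a set $\mathcal{A}$ of $\zeta$ different values uniformly at random from $\{1,\dots,d'\}$. 3. For each $i\in\mathcal{A}$: - if feature $i$ is numerical, let $y$ be the output of the piecewise mechanism $\mathcal{M}_{\epsilon/\zeta}$ applied to $\mathbf{x}_{(i)}$ (with privacy parameter $\epsilon/\zeta$), and set $\widehat{\mathbf{x}}_{(i)}=\frac{d'}{\zeta}\,y$; - if feature $i$ is categorical, replace each entry $c\in\{0,1\}$ of the one-hot vector $\mathbf{x}_{(i)}$ by a value $c'\in\{0,1\}$ drawn independently with $\Pr[c'=1]=\frac12$ if $c=1$ and $\Pr[c'=1]=\frac{1}{\exp(\epsilon/\zeta)+1}$ if $c=0$, and let $\widehat{\mathbf{x}}_{(i)}$ be the resulting vector. 4. Output $\widehat{\mathbf{x}}$. Then this algorithm satisfies $\epsilon$-local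 differential privacy.
   Context: A randomized function $f$ satisfies $\epsilon$-local differential privacy if for any two inputs $t,t'$ in its input domain and every output $t^*$, $\Pr[f(t)=t^*]\le \exp(\epsilon)\cdot\Pr[f(t')=t^*]$, where for continuous outputs probabilities are replaced by densities; equivalently (and covering mixed discrete/continuous outputs), $\Pr[f(t)\in O]\le \exp(\epsilon)\Pr[f(t')\in O]$ for every measurable set $O$ of outputs. $\oplus$ denotes concatenation of vectors. A one-hot vector is a $0/1$ vector with exactly one entry equal to $1$. All random draws in different steps and for different features are independent. Piecewise mechanism $\mathcal{M}_{\delta}$ with parameter $\delta>0$: for input $x\in[-1,1]$, set $C=\frac{\exp(\delta/2)+1}{\exp(\delta/2)-1}$, $\ell(x)=\frac{C+1}{2}x-\frac{C-1}{2}$, $\pi(x)=\ell(x)+C-1$. Sample $\xi$ uniformly from $[0,1]$; if $\xi<\frac{\exp(\delta/2)}{\exp(\delta/2)+1}$ output a uniform sample from $[\ell(x),\pi(x)]$, otherwise output a uniform sample from $[-C,\ell(x))\cup(\pi(x),C]$. *)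

theory Defs
  imports "HOL-Probability.Probability"
begin

text \<open>A randomized function from \<open>X\<close> to the measurable space \<open>N\<close> is a map assigning to each input
  its output distribution, a probability measure on \<open>N\<close>.\<close>

definition local_dp :: "real \<Rightarrow> 'a set \<Rightarrow> 'b measure \<Rightarrow> ('a \<Rightarrow> 'b measure) \<Rightarrow> bool" where
  "local_dp \<epsilon> X N f \<longleftrightarrow>
     (\<forall>t\<in>X. prob_space (f t) \<and> sets (f t) = sets N) \<and>
     (\<forall>t\<in>X. \<forall>t'\<in>X. \<forall>S\<in>sets N. measure (f t) S \<le> exp \<epsilon> * measure (f t') S)"


text \<open>A real vector of length \<open>n\<close> is an extensional function on \<open>{..<n}\<close>; features and coordinates
  are numbered from 0. A numerical feature is a vector of length 1.\<close>

abbreviation vec_space :: "nat \<Rightarrow> (nat \<Rightarrow> real) measure" where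
  "vec_space n \<equiv> PiM {..<n} (\<lambda>_. borel)"

datatype feature_kind = Numerical | Categorical nat

fun feature_width :: "feature_kind \<Rightarrow> nat" where
  "feature_width Numerical = 1"
| "feature_width (Categorical k) = k"

definition one_hot :: "nat \<Rightarrow> (nat \<Rightarrow> real) set" where
  "one_hot k = {v \<in> {..<k} \<rightarrow>\<^sub>E {0, 1}. \<exists>!j. j < k \<and> v j = 1}"

fun feature_domain :: "feature_kind \<Rightarrow> (nat \<Rightarrow> real) set" where
  "feature_domain Numerical = {..<1} \<rightarrow>\<^sub>E {-1..1}"
| "feature_domain (Categorical k) = one_hot k"


text \<open>In the following, \<open>w i\<close> is the length of the \<open>i\<close>-th block. The vector \<open>vec_concat w d b\<close> is
  the concatenation of \<open>b 0, \<dots>, b (d - 1)\<close>, and \<open>vec_block w x i\<close> recovers the \<open>i\<close>-th block.\<close>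

definition block_offset :: "(nat \<Rightarrow> nat) \<Rightarrow> nat \<Rightarrow> nat" where
  "block_offset w i = (\<Sum>j<i. w j)"

definition vec_concat :: "(nat \<Rightarrow> nat) \<Rightarrow> nat \<Rightarrow> (nat \<Rightarrow> nat \<Rightarrow> real) \<Rightarrow> nat \<Rightarrow> real" where
  "vec_concat w d b =
     (\<lambda>n\<in>{..<block_offset w d}. concat (map (\<lambda>i. map (b i) [0..<w i]) [0..<d]) ! n)"

definition vec_block :: "(nat \<Rightarrow> nat) \<Rightarrow> (nat \<Rightarrow> real) \<Rightarrow> nat \<Rightarrow> nat \<Rightarrow> real" where
  "vec_block w x i = (\<lambda>j\<in>{..<w i}. x (block_offset w i + j))"

lemma block_offset_mono: "i \<le> d \<Longrightarrow> block_offset w i \<le> block_offset w d"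
  unfolding block_offset_def by (rule sum_mono2) auto

lemma length_concat_blocks:
  "length (concat (map (\<lambda>i. map (b i) [0..<w i]) [0..<d])) = block_offset w d"
  by (induction d) (auto simp: block_offset_def)

lemma nth_concat_blocks:
  assumes "i < d" "j < w i"
  shows "concat (map (\<lambda>i. map (b i) [0..<w i]) [0..<d]) ! (block_offset w i + j) = b i j"
  using assms(1)
proof (induction d)
  case (Suc d)
  show ?case
  proof (cases "i = d")
    case True
    then show ?thesis using assms(2) by (simp add: nth_append length_concat_blocks)
  next
    case False
    with Suc have "i < d" by simp
    moreover have "block_offset w i + j < block_offset w d"
      using block_offset_mono[of "Suc i" d w] \<open>i < d\<close> assms(2) by (simp add: block_offset_def)
    ultimately show ?thesis using Suc by (simp add: nth_append length_concat_blocks)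
  qed
qed simp

lemma vec_block_concat:
  assumes "i < d" "b i \<in> extensional {..<w i}"
  shows "vec_block w (vec_concat w d b) i = b i"
proof
  fix j
  show "vec_block w (vec_concat w d b) i j = b i j"
  proof (cases "j < w i")
    case True
    then have "block_offset w i + j < block_offset w d"
      using block_offset_mono[of "Suc i" d w] assms(1) by (simp add: block_offset_def)
    with True assms(1) show ?thesis
      by (simp add: vec_block_def vec_concat_def nth_concat_blocks)
  next
    case False
    then show ?thesis using assms(2) by (simp add: vec_block_def extensional_def)
  qed
qed


text \<open>Input vectors with \<open>d\<close> features, feature \<open>i\<close> being of kind \<open>F i\<close>, and the measurable space of
  output vectors.\<close>

abbreviation widths :: "(nat \<Rightarrow> feature_kind) \<Rightarrow> nat \<Rightarrow> nat" where
  "widths F \<equiv> (\<lambda>i. feature_width (F i))"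

definition input_domain :: "(nat \<Rightarrow> feature_kind) \<Rightarrow> nat \<Rightarrow> (nat \<Rightarrow> real) set" where
  "input_domain F d = {vec_concat (widths F) d b |b. \<forall>i<d. b i \<in> feature_domain (F i)}"

abbreviation output_space :: "(nat \<Rightarrow> feature_kind) \<Rightarrow> nat \<Rightarrow> (nat \<Rightarrow> real) measure" where
  "output_space F d \<equiv> vec_space (block_offset (widths F) d)"


definition pm_C :: "real \<Rightarrow> real" where
  "pm_C \<delta> = (exp (\<delta> / 2) + 1) / (exp (\<delta> / 2) - 1)"

definition pm_l :: "real \<Rightarrow> real \<Rightarrow> real" where
  "pm_l \<delta> x = (pm_C \<delta> + 1) / 2 * x - (pm_C \<delta> - 1) / 2"

definition pm_r :: "real \<Rightarrow> real \<Rightarrow> real" where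
  "pm_r \<delta> x = pm_l \<delta> x + pm_C \<delta> - 1"

definition piecewise_mechanism :: "real \<Rightarrow> real \<Rightarrow> real measure" where
  "piecewise_mechanism \<delta> x =
     uniform_measure lborel {0..1} \<bind> (\<lambda>\<xi>.
       if \<xi> < exp (\<delta> / 2) / (exp (\<delta> / 2) + 1)
       then uniform_measure lborel {pm_l \<delta> x..pm_r \<delta> x}
       else uniform_measure lborel ({- pm_C \<delta>..<pm_l \<delta> x} \<union> {pm_r \<delta> x<..pm_C \<delta>}))"


definition perturb_numerical :: "nat \<Rightarrow> nat \<Rightarrow> real \<Rightarrow> (nat \<Rightarrow> real) \<Rightarrow> (nat \<Rightarrow> real) measure" where
  "perturb_numerical d \<zeta> \<epsilon> v =
     distr (piecewise_mechanism (\<epsilon> / real \<zeta>) (v 0)) (vec_space 1)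
       (\<lambda>y. \<lambda>j\<in>{..<1}. real d / real \<zeta> * y)"

definition flip_entry :: "real \<Rightarrow> real \<Rightarrow> real measure" where
  "flip_entry \<delta> c =
     distr (measure_pmf (bernoulli_pmf (if c = 1 then 1 / 2 else 1 / (exp \<delta> + 1)))) borel of_bool"

definition perturb_categorical :: "nat \<Rightarrow> nat \<Rightarrow> real \<Rightarrow> (nat \<Rightarrow> real) \<Rightarrow> (nat \<Rightarrow> real) measure" where
  "perturb_categorical k \<zeta> \<epsilon> v = PiM {..<k} (\<lambda>j. flip_entry (\<epsilon> / real \<zeta>) (v j))"

fun perturb_feature ::
  "feature_kind \<Rightarrow> nat \<Rightarrow> nat \<Rightarrow> real \<Rightarrow> (nat \<Rightarrow> real) \<Rightarrow> (nat \<Rightarrow> real) measure" where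
  "perturb_feature Numerical d \<zeta> \<epsilon> v = perturb_numerical d \<zeta> \<epsilon> v"
| "perturb_feature (Categorical k) d \<zeta> \<epsilon> v = perturb_categorical k \<zeta> \<epsilon> v"

text \<open>The output distribution on input \<open>x\<close>. Given the sampled set \<open>A\<close>, the blocks are independent,
  and those outside \<open>A\<close> keep their initial value 0.\<close>

definition perturb_vector ::
  "(nat \<Rightarrow> feature_kind) \<Rightarrow> nat \<Rightarrow> nat \<Rightarrow> real \<Rightarrow> (nat \<Rightarrow> real) \<Rightarrow> (nat \<Rightarrow> real) measure" where
  "perturb_vector F d \<zeta> \<epsilon> x =
     measure_pmf (pmf_of_set {A. A \<subseteq> {..<d} \<and> card A = \<zeta>}) \<bind> (\<lambda>A.
       distr
         (PiM {..<d} (\<lambda>i.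
            if i \<in> A then perturb_feature (F i) d \<zeta> \<epsilon> (vec_block (widths F) x i)
            else return (vec_space (widths F i)) (\<lambda>j\<in>{..<widths F i}. 0)))
         (output_space F d)
         (vec_concat (widths F) d))"

end

theory Submission
  imports Defs
begin

text \<open>Domination of measures \<open>M \<le> scale_measure c N\<close> is stable under images, mixtures and finite
  products, where the constants multiply. On an entry that is 1 in one input and 0 in the other,
  the ratio of the output probabilities is at most \<open>(exp \<delta> + 1) / 2\<close> in one direction and at most
  \<open>2 * exp \<delta> / (exp \<delta> + 1)\<close> in the other. Two one-hot vectors differ in at most one entry of each
  sort and the product of these two bounds is \<open>exp \<delta>\<close>, so every perturbed feature costs a factor
  \<open>exp (\<epsilon> / \<zeta>)\<close>, and \<open>\<zeta>\<close> of them are perturbed.\<close>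

section \<open>Domination of measures up to a constant factor\<close>

lemma le_scale_measure_iff:
  assumes "sets M = sets N"
  shows "M \<le> scale_measure c N \<longleftrightarrow> (\<forall>A\<in>sets M. emeasure M A \<le> c * emeasure N A)"
  \<comment> \<open>The order on measures compares spaces and sigma-algebras before values, so
    equality of \<open>sets\<close> is what turns domination into a setwise inequality.\<close>
  using assms by (simp add: le_measure)

lemma nn_integral_le_scale_measure:
  assumes "sets M = sets N" "M \<le> scale_measure c N" "f \<in> borel_measurable N"
  shows "(\<integral>\<^sup>+x. f x \<partial>M) \<le> c * (\<integral>\<^sup>+x. f x \<partial>N)"
proof -
  have "(\<integral>\<^sup>+x. f x \<partial>M) \<le> (\<integral>\<^sup>+x. f x \<partial>scale_measure c N)"
    using assms by (intro nn_integral_mono_measure) auto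
  then show ?thesis using assms by (simp add: nn_integral_scale_measure)
qed

text \<open>Post-processing: the mass of a set under the image measure is the mass of its preimage,
  so a map that is the same for both inputs costs nothing.\<close>

lemma distr_le_scale_measure:
  assumes "sets M = sets N" "M \<le> scale_measure c N" "f \<in> measurable N L"
  shows "distr M L f \<le> scale_measure c (distr N L f)"
proof -
  have f: "f \<in> measurable M L"
    using assms by (simp cong: measurable_cong_sets)
  have "emeasure (distr M L f) A \<le> c * emeasure (distr N L f) A" if "A \<in> sets L" for A
    using that f assms sets_eq_imp_space_eq[OF assms(1)]
    by (auto simp: emeasure_distr le_scale_measure_iff measurable_sets)
  then show ?thesis by (simp add: le_scale_measure_iff)
qed

text \<open>By Fubini a product measure integrates the masses of sections. Domination of the second
  factor bounds each section by \<open>c2\<close>; domination of the first then bounds the integral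
  by \<open>c1\<close>.\<close>

lemma pair_measure_le_scale_measure:
  assumes "prob_space M1" "prob_space M2" "prob_space N1" "prob_space N2"
    and sets1: "sets M1 = sets N1" and sets2: "sets M2 = sets N2"
    and le1: "M1 \<le> scale_measure c1 N1" and le2: "M2 \<le> scale_measure c2 N2"
  shows "M1 \<Otimes>\<^sub>M M2 \<le> scale_measure (c1 * c2) (N1 \<Otimes>\<^sub>M N2)"
proof -
  interpret M1: prob_space M1 by fact
  interpret M2: prob_space M2 by fact
  interpret N1: prob_space N1 by fact
  interpret N2: prob_space N2 by fact
  have sets: "sets (M1 \<Otimes>\<^sub>M M2) = sets (N1 \<Otimes>\<^sub>M N2)"
    using sets1 sets2 by (rule sets_pair_measure_cong)
  have "emeasure (M1 \<Otimes>\<^sub>M M2) A \<le> (c1 * c2) * emeasure (N1 \<Otimes>\<^sub>M N2) A"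
    if A: "A \<in> sets (M1 \<Otimes>\<^sub>M M2)" for A
  proof -
    have A': "A \<in> sets (N1 \<Otimes>\<^sub>M N2)" using A sets by simp
    have meas: "(\<lambda>x. emeasure N2 (Pair x -` A)) \<in> borel_measurable N1"
      by (rule N2.measurable_emeasure_Pair[OF A'])
    have "emeasure (M1 \<Otimes>\<^sub>M M2) A = (\<integral>\<^sup>+x. emeasure M2 (Pair x -` A) \<partial>M1)"
      by (rule M2.emeasure_pair_measure_alt[OF A])
    also have "\<dots> \<le> (\<integral>\<^sup>+x. c2 * emeasure N2 (Pair x -` A) \<partial>M1)"
      using le2 sets_Pair1[OF A] by (intro nn_integral_mono) (simp add: le_scale_measure_iff sets2)
    also have "\<dots> \<le> c1 * (\<integral>\<^sup>+x. c2 * emeasure N2 (Pair x -` A) \<partial>N1)"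
      using meas by (intro nn_integral_le_scale_measure sets1 le1) simp
    also have "\<dots> = (c1 * c2) * emeasure (N1 \<Otimes>\<^sub>M N2) A"
      using meas by (simp add: nn_integral_cmult N2.emeasure_pair_measure_alt[OF A'] mult.assoc)
    finally show ?thesis .
  qed
  then show ?thesis by (simp add: le_scale_measure_iff[OF sets])
qed

lemma PiM_le_scale_measure:
  fixes c :: "'i \<Rightarrow> ennreal"
  assumes "finite I"
    and "\<And>i. i \<in> I \<Longrightarrow> prob_space (M i)" "\<And>i. i \<in> I \<Longrightarrow> prob_space (N i)"
    and "\<And>i. i \<in> I \<Longrightarrow> sets (M i) = sets (N i)"
    and "\<And>i. i \<in> I \<Longrightarrow> M i \<le> scale_measure (c i) (N i)"
  shows "PiM I M \<le> scale_measure (\<Prod>i\<in>I. c i) (PiM I N)"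
  using assms
proof (induction I)
  case empty
  then show ?case by (simp add: PiM_empty)
next
  case (insert i I)
  let ?up = "\<lambda>(x, X). X(i := x)"
  have sets_I: "sets (PiM I M) = sets (PiM I N)"
    and sets_ins: "sets (PiM (insert i I) M) = sets (PiM (insert i I) N)"
    using insert.prems(3) by (auto intro!: sets_PiM_cong)
  have up: "?up \<in> measurable (N i \<Otimes>\<^sub>M PiM I N) (PiM (insert i I) N)"
    by measurable
  have le: "M i \<Otimes>\<^sub>M PiM I M \<le> scale_measure (c i * (\<Prod>i\<in>I. c i)) (N i \<Otimes>\<^sub>M PiM I N)"
    using insert sets_I by (intro pair_measure_le_scale_measure prob_space_PiM) auto
  have "PiM (insert i I) M = distr (M i \<Otimes>\<^sub>M PiM I M) (PiM (insert i I) M) ?up"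
    using insert.prems by (intro distr_pair_PiM_eq_PiM[symmetric]) auto
  \<comment> \<open>The target sigma-algebra is exchanged for the equal one built from
    \<open>N\<close>, so that both images use the same target.\<close>
  also have "\<dots> = distr (M i \<Otimes>\<^sub>M PiM I M) (PiM (insert i I) N) ?up"
    using sets_ins by (intro distr_cong) auto
  also have "\<dots> \<le> scale_measure (c i * (\<Prod>i\<in>I. c i))
                     (distr (N i \<Otimes>\<^sub>M PiM I N) (PiM (insert i I) N) ?up)"
    using insert.prems(3) sets_I le up
    by (intro distr_le_scale_measure) (auto intro!: sets_pair_measure_cong)
  also have "distr (N i \<Otimes>\<^sub>M PiM I N) (PiM (insert i I) N) ?up = PiM (insert i I) N"
    using insert.prems by (intro distr_pair_PiM_eq_PiM) auto
  finally show ?case using insert.hyps by simp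
qed

lemma measure_pmf_le_scale_measure:
  assumes "\<And>x. pmf p x \<le> c * pmf q x" "c \<ge> 0"
  shows "measure_pmf p \<le> scale_measure (ennreal c) (measure_pmf q)"
proof -
  have "emeasure (measure_pmf p) A \<le> ennreal c * emeasure (measure_pmf q) A" for A
  proof -
    have "emeasure (measure_pmf p) A = (\<integral>\<^sup>+x. ennreal (pmf p x) \<partial>count_space A)"
      by (simp add: nn_integral_pmf)
    also have "\<dots> \<le> (\<integral>\<^sup>+x. ennreal c * ennreal (pmf q x) \<partial>count_space A)"
      using assms by (intro nn_integral_mono) (simp add: ennreal_mult[symmetric] ennreal_leI)
    also have "\<dots> = ennreal c * emeasure (measure_pmf q) A"
      by (simp add: nn_integral_cmult nn_integral_pmf)
    finally show ?thesis .
  qed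
  then show ?thesis by (simp add: le_scale_measure_iff)
qed

subsection \<open>The piecewise mechanism\<close>

text \<open>\<open>pm_C \<delta> - 1\<close> is the length of the central interval and
  \<open>pm_C \<delta> + 1\<close> that of its complement in [-C, C]; the last claim makes both
  positive.\<close>

lemma pm_C_bounds:
  assumes "\<delta> > 0"
  shows "pm_C \<delta> - 1 = 2 / (exp (\<delta> / 2) - 1)" "pm_C \<delta> + 1 = 2 * exp (\<delta> / 2) / (exp (\<delta> / 2) - 1)"
    "pm_C \<delta> > 1"
proof -
  have s: "exp (\<delta> / 2) > 1" using assms by simp
  then show *: "pm_C \<delta> - 1 = 2 / (exp (\<delta> / 2) - 1)"
    and "pm_C \<delta> + 1 = 2 * exp (\<delta> / 2) / (exp (\<delta> / 2) - 1)"
    unfolding pm_C_def by (simp_all add: field_simps)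
  have "2 / (exp (\<delta> / 2) - 1) > 0" using s by simp
  then show "pm_C \<delta> > 1" using * by linarith
qed

text \<open>The endpoints are increasing and affine in \<open>x\<close>, with
  \<open>pm_l \<delta> (-1) = - pm_C \<delta>\<close> and
  \<open>pm_r \<delta> 1 = pm_C \<delta>\<close>, so the central interval slides from one end of
  [-C, C] to the other.\<close>

lemma pm_interval:
  assumes "\<delta> > 0" "x \<in> {-1..1}"
  shows "- pm_C \<delta> \<le> pm_l \<delta> x" "pm_l \<delta> x \<le> pm_r \<delta> x" "pm_r \<delta> x \<le> pm_C \<delta>"
    "pm_r \<delta> x - pm_l \<delta> x = pm_C \<delta> - 1"
proof -
  have C: "pm_C \<delta> > 1" by (rule pm_C_bounds(3)[OF assms(1)])
  have "(pm_C \<delta> + 1) / 2 * (-1) \<le> (pm_C \<delta> + 1) / 2 * x"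
    using C assms by (intro mult_left_mono) auto
  then show "- pm_C \<delta> \<le> pm_l \<delta> x" unfolding pm_l_def by argo
  have "(pm_C \<delta> + 1) / 2 * x \<le> (pm_C \<delta> + 1) / 2 * 1"
    using C assms by (intro mult_left_mono) auto
  then show "pm_r \<delta> x \<le> pm_C \<delta>" unfolding pm_r_def pm_l_def by argo
  show "pm_l \<delta> x \<le> pm_r \<delta> x" "pm_r \<delta> x - pm_l \<delta> x = pm_C \<delta> - 1"
    using C unfolding pm_r_def by auto
qed

text \<open>The two coefficients are the values of the output density. The central interval has
  probability s/(s+1) and length 2/(s-1); the outer part has probability 1/(s+1) and length
  2s/(s-1).\<close>

lemma piecewise_mechanism_props:
  fixes \<delta> x :: real
  defines "s \<equiv> exp (\<delta> / 2)"
  defines "I \<equiv> {pm_l \<delta> x..pm_r \<delta> x}"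
  defines "J \<equiv> {- pm_C \<delta>..<pm_l \<delta> x} \<union> {pm_r \<delta> x<..pm_C \<delta>}"
  assumes "\<delta> > 0" "x \<in> {-1..1}"
  shows "prob_space (piecewise_mechanism \<delta> x)"
    and "sets (piecewise_mechanism \<delta> x) = sets borel"
    and "S \<in> sets borel \<Longrightarrow> emeasure (piecewise_mechanism \<delta> x) S =
      ennreal (s * (s - 1) / (2 * (s + 1))) * emeasure lborel (I \<inter> S) +
      ennreal ((s - 1) / (2 * s * (s + 1))) * emeasure lborel (J \<inter> S)"
proof -
  note C = pm_C_bounds[OF assms(4), folded s_def] and int = pm_interval[OF assms(4,5)]
  have s: "s > 1" using assms by (simp add: s_def)
  let ?t = "s / (s + 1)"
  let ?f = "\<lambda>\<xi>::real. if \<xi> < ?t then uniform_measure lborel I else uniform_measure lborel J"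
  let ?U = "uniform_measure lborel {0..1::real}"
  have t: "0 < ?t" "?t < 1" using s by auto
  have I: "emeasure lborel I = ennreal (pm_C \<delta> - 1)"
    using int by (simp add: I_def)
  have "emeasure lborel J =
      emeasure lborel {- pm_C \<delta>..<pm_l \<delta> x} + emeasure lborel {pm_r \<delta> x<..pm_C \<delta>}"
    unfolding J_def using int by (intro plus_emeasure[symmetric]) auto
  \<comment> \<open>The two outer pieces are what an interval of length C - 1 leaves of [-C, C],
    hence 2C - (C - 1).\<close>
  also have "\<dots> = ennreal (pm_C \<delta> + 1)"
    using int by (simp add: ennreal_plus[symmetric] algebra_simps del: ennreal_plus)
  finally have J: "emeasure lborel J = ennreal (pm_C \<delta> + 1)" .
  have prob: "prob_space (uniform_measure lborel I)" "prob_space (uniform_measure lborel J)"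
    using I J C(3) by (auto intro!: prob_space_uniform_measure simp del: ennreal_plus)
  have probU: "prob_space ?U"
    by (rule prob_space_uniform_measure) auto
  interpret U: prob_space ?U by (rule probU)
  have pm: "piecewise_mechanism \<delta> x = ?U \<bind> ?f"
    unfolding piecewise_mechanism_def I_def J_def s_def ..
  have f: "?f \<in> measurable ?U (prob_algebra borel)"
    using prob by (intro measurable_If measurable_const) (auto simp: space_prob_algebra)
  \<comment> \<open>The rule used here concerns binds that depend on a parameter; a constant family
    over \<open>count_space UNIV\<close> specialises it to a single bind.\<close>
  have "?U \<bind> ?f \<in> space (prob_algebra borel)"
    using probU f
    by (intro measurable_bind_prob_space2[THEN measurable_space, of "\<lambda>_. ?U" "count_space UNIV" ?U]
        prob_space_imp_subprob_space) (auto simp: space_prob_algebra)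
  then show "prob_space (piecewise_mechanism \<delta> x)" "sets (piecewise_mechanism \<delta> x) = sets borel"
    by (auto simp: pm space_prob_algebra)
  show "emeasure (piecewise_mechanism \<delta> x) S =
      ennreal (s * (s - 1) / (2 * (s + 1))) * emeasure lborel (I \<inter> S) +
      ennreal ((s - 1) / (2 * s * (s + 1))) * emeasure lborel (J \<inter> S)"
    if S: "S \<in> sets borel"
  proof -
    let ?u = "emeasure (uniform_measure lborel I) S" and ?v = "emeasure (uniform_measure lborel J) S"
    have "emeasure (piecewise_mechanism \<delta> x) S = (\<integral>\<^sup>+\<xi>. emeasure (?f \<xi>) S \<partial>?U)"
      unfolding pm using f S by (intro emeasure_bind) (auto intro: measurable_prob_algebraD)
    \<comment> \<open>The integrand depends on \<open>\<xi>\<close> only through the branch taken,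
      so the integral reduces to the probabilities of the two branches.\<close>
    also have "\<dots> = (\<integral>\<^sup>+\<xi>. ?u * indicator {..<?t} \<xi> + ?v * indicator {?t..} \<xi> \<partial>?U)"
      by (intro nn_integral_cong) (auto split: split_indicator)
    also have "\<dots> = ?u * emeasure ?U {..<?t} + ?v * emeasure ?U {?t..}"
      by (subst nn_integral_add) (auto simp: nn_integral_cmult_indicator)
    also have "emeasure ?U {..<?t} = ennreal ?t"
    proof -
      have "{0..1} \<inter> {..<?t} = {0..<?t}" using t by auto
      then show ?thesis using t by (simp add: divide_ennreal_def)
    qed
    also have "emeasure ?U {?t..} = ennreal (1 - ?t)"
    proof -
      have "{0..1} \<inter> {?t..} = {?t..1}" using t by auto
      then show ?thesis using t by (simp add: divide_ennreal_def)
    qed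
    also have "?u = emeasure lborel (I \<inter> S) * ennreal (1 / (pm_C \<delta> - 1))"
    proof -
      have "I \<in> sets borel" by (simp add: I_def)
      then show ?thesis using S C(3) I
        by (simp add: divide_ennreal_def inverse_ennreal inverse_eq_divide del: ennreal_plus)
    qed
    also have "?v = emeasure lborel (J \<inter> S) * ennreal (1 / (pm_C \<delta> + 1))"
    proof -
      have "J \<in> sets borel" by (simp add: J_def)
      then show ?thesis using S C(3) J
        by (simp add: divide_ennreal_def inverse_ennreal inverse_eq_divide del: ennreal_plus)
    qed
    finally have "emeasure (piecewise_mechanism \<delta> x) S =
        ennreal (1 / (pm_C \<delta> - 1) * ?t) * emeasure lborel (I \<inter> S) +
        ennreal (1 / (pm_C \<delta> + 1) * (1 - ?t)) * emeasure lborel (J \<inter> S)"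
      using C(3) t by (simp only: ennreal_mult less_imp_le diff_ge_0_iff_ge zero_le_divide_1_iff
          add_nonneg_nonneg zero_le_one mult_ac)
    moreover have "1 / (pm_C \<delta> - 1) * ?t = s * (s - 1) / (2 * (s + 1))"
      using s by (simp add: C(1) field_simps)
    moreover have "1 / (pm_C \<delta> + 1) * (1 - ?t) = (s - 1) / (2 * s * (s + 1))"
      using s unfolding C(2) by (simp add: divide_simps)
    ultimately show ?thesis by simp
  qed
qed

text \<open>The output density takes two values on \<open>[-C, C]\<close>, whatever the input, and their ratio is
  \<open>exp (\<delta> / 2) ^ 2\<close>.\<close>

lemma piecewise_mechanism_dp:
  assumes "\<delta> > 0" "x \<in> {-1..1}" "y \<in> {-1..1}"
  shows "piecewise_mechanism \<delta> x \<le> scale_measure (ennreal (exp \<delta>)) (piecewise_mechanism \<delta> y)"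
proof -
  define s where "s = exp (\<delta> / 2)"
  define b where "b = (s - 1) / (2 * s * (s + 1))"
  define a where "a = s * (s - 1) / (2 * (s + 1))"
  define I where "I = (\<lambda>x. {pm_l \<delta> x..pm_r \<delta> x})"
  define J where "J = (\<lambda>x. {- pm_C \<delta>..<pm_l \<delta> x} \<union> {pm_r \<delta> x<..pm_C \<delta>})"
  have s: "s > 1" using assms by (simp add: s_def)
  have b: "b \<ge> 0" using s by (simp add: b_def)
  have "exp \<delta> = s * s" by (simp add: s_def flip: exp_add)
  then have ab: "a = exp \<delta> * b" using s by (simp add: a_def b_def divide_simps)
  have "b \<le> a" using b assms(1) by (simp add: ab mult_right_mono[of 1 "exp \<delta>" b, simplified])
  have split: "emeasure lborel ({- pm_C \<delta>..pm_C \<delta>} \<inter> S) =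
      emeasure lborel (I z \<inter> S) + emeasure lborel (J z \<inter> S)"
    if "z \<in> {-1..1}" "S \<in> sets borel" for z S
  proof -
    have "{- pm_C \<delta>..pm_C \<delta>} \<inter> S = (I z \<inter> S) \<union> (J z \<inter> S)"
      using pm_interval[OF assms(1) that(1)] by (auto simp: I_def J_def)
    moreover have "(I z \<inter> S) \<inter> (J z \<inter> S) = {}" by (auto simp: I_def J_def)
    ultimately show ?thesis using that by (simp add: plus_emeasure I_def J_def)
  qed
  note sets = piecewise_mechanism_props(2)[OF assms(1)]
  have em: "emeasure (piecewise_mechanism \<delta> z) S =
      ennreal a * emeasure lborel (I z \<inter> S) + ennreal b * emeasure lborel (J z \<inter> S)"
    if "z \<in> {-1..1}" "S \<in> sets borel" for z S
    using piecewise_mechanism_props(3)[OF assms(1) that] by (simp add: I_def J_def a_def b_def s_def)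
  have "emeasure (piecewise_mechanism \<delta> x) S \<le> ennreal (exp \<delta>) * emeasure (piecewise_mechanism \<delta> y) S"
    if S: "S \<in> sets borel" for S
  proof -
    \<comment> \<open>Raising the density to its larger value \<open>a\<close> on all of [-C, C]
      gives a bound in which \<open>x\<close> no longer occurs.\<close>
    have "emeasure (piecewise_mechanism \<delta> x) S \<le> ennreal a * emeasure lborel ({- pm_C \<delta>..pm_C \<delta>} \<inter> S)"
      unfolding em[OF assms(2) S] split[OF assms(2) S] distrib_left
      using \<open>b \<le> a\<close> by (intro add_mono mult_right_mono ennreal_leI) auto
    also have "\<dots> = ennreal (exp \<delta>) * (ennreal b * emeasure lborel ({- pm_C \<delta>..pm_C \<delta>} \<inter> S))"
      using b by (simp add: ab ennreal_mult mult.assoc)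
    \<comment> \<open>Conversely, the density for \<open>y\<close> is at least \<open>b\<close> on
      all of [-C, C].\<close>
    also have "\<dots> \<le> ennreal (exp \<delta>) * emeasure (piecewise_mechanism \<delta> y) S"
      unfolding em[OF assms(3) S] split[OF assms(3) S] distrib_left
      using \<open>b \<le> a\<close> by (intro add_mono mult_left_mono mult_right_mono ennreal_leI) auto
    finally show ?thesis .
  qed
  then show ?thesis using sets assms by (simp add: le_scale_measure_iff)
qed

subsection \<open>Perturbation of a single feature\<close>

lemma prob_space_flip_entry [simp]: "prob_space (flip_entry \<delta> c)"
  unfolding flip_entry_def by (rule measure_pmf.prob_space_distr) simp

lemma sets_flip_entry [simp]: "sets (flip_entry \<delta> c) = sets borel"
  by (simp add: flip_entry_def)

text \<open>The constant is a factor depending on \<open>u\<close> alone times one depending on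
  \<open>v\<close> alone, so that a product over entries separates. It is attained at output 1 if
  only \<open>u\<close> is 1, and at output 0 if only \<open>v\<close> is 1; if both are 1, it is
  \<open>E\<close>, larger than the true ratio 1.\<close>

lemma flip_entry_dp:
  fixes \<delta> u v :: real
  defines "E \<equiv> exp \<delta>"
  assumes "\<delta> > 0"
  shows "flip_entry \<delta> u \<le> scale_measure
    (ennreal ((if u = 1 then (E + 1) / 2 else 1) * (if v = 1 then 2 * E / (E + 1) else 1)))
    (flip_entry \<delta> v)"
  unfolding flip_entry_def
proof (intro distr_le_scale_measure measure_pmf_le_scale_measure)
  have E: "E > 1" using assms by simp
  have E1: "1 / (E + 1) \<le> 1" "E + 1 \<noteq> 0" "0 < E + 1" using E by auto
  \<comment> \<open>\<open>1 \<le> E\<close> with denominators cleared, prepared in two arrangements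
    for the case analysis with \<open>divide_simps\<close>.\<close>
  have "(E + 1) * 1 \<le> (E + 1) * E" using E by (intro mult_left_mono) auto
  then have E2: "E * 2 + 2 \<le> 2 * E * (E + 1)" "2 * E + 2 \<le> (E + 1) * E * 2"
    by (simp_all add: algebra_simps)
  let ?p = "\<lambda>u. bernoulli_pmf (if u = 1 then 1 / 2 else 1 / (exp \<delta> + 1))"
  let ?c = "(if u = 1 then (E + 1) / 2 else 1) * (if v = 1 then 2 * E / (E + 1) else 1)"
  show "?c \<ge> 0" using E by simp
  show "pmf (?p u) x \<le> ?c * pmf (?p v) x" for x
    using E E1 E2 by (cases x; cases "u = 1"; cases "v = 1") (simp_all add: E_def[symmetric] divide_simps)
qed auto

lemma perturb_categorical_dp:
  assumes "\<delta> > 0" "\<delta> = \<epsilon> / real \<zeta>" "u \<in> one_hot k" "v \<in> one_hot k"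
  shows "perturb_categorical k \<zeta> \<epsilon> u \<le> scale_measure (ennreal (exp \<delta>)) (perturb_categorical k \<zeta> \<epsilon> v)"
proof -
  let ?E = "exp \<delta>"
  let ?c = "\<lambda>j. (if u j = 1 then (?E + 1) / 2 else 1) * (if v j = 1 then 2 * ?E / (?E + 1) else 1)"
  obtain a where a: "a < k" "\<And>j. j < k \<Longrightarrow> u j = 1 \<longleftrightarrow> j = a"
    using assms(3) by (auto simp: one_hot_def)
  obtain b where b: "b < k" "\<And>j. j < k \<Longrightarrow> v j = 1 \<longleftrightarrow> j = b"
    using assms(4) by (auto simp: one_hot_def)
  have "(\<Prod>j<k. ?c j) =
      (\<Prod>j<k. (if j = a then (?E + 1) / 2 else 1) * (if j = b then 2 * ?E / (?E + 1) else 1))"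
    using a b by (intro prod.cong) auto
  \<comment> \<open>The product separates into one over the factors of \<open>u\<close> and one over
    those of \<open>v\<close>, each with a single nontrivial factor. Hence \<open>a = b\<close>
    needs no separate treatment.\<close>
  also have "\<dots> = (?E + 1) / 2 * (2 * ?E / (?E + 1))"
    using a(1) b(1) by (simp add: prod.distrib)
  also have "\<dots> = ?E"
  proof -
    have "?E + 1 > 0" by (intro add_pos_pos) auto
    then show ?thesis by (simp add: divide_simps)
  qed
  finally have "(\<Prod>j<k. ennreal (?c j)) = ennreal ?E"
    by (subst prod_ennreal) (auto intro: add_nonneg_nonneg)
  then show ?thesis
    using PiM_le_scale_measure[of "{..<k}" "\<lambda>j. flip_entry \<delta> (u j)" "\<lambda>j. flip_entry \<delta> (v j)"
        "\<lambda>j. ennreal (?c j)"] flip_entry_dp[OF assms(1)]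
    by (simp add: perturb_categorical_def assms(2))
qed

lemma feature_domain_Numerical:
  assumes "v \<in> feature_domain Numerical"
  shows "v 0 \<in> {-1..1}"
proof -
  have "v \<in> {..<1} \<rightarrow>\<^sub>E {-1..1}" using assms by (simp only: feature_domain.simps)
  then show ?thesis by (rule PiE_mem) simp
qed

lemma measurable_scale_numerical:
  assumes "sets M = sets borel"
  shows "(\<lambda>y. \<lambda>j\<in>{..<1::nat}. a * y) \<in> measurable M (vec_space 1)"
proof -
  have "(\<lambda>y. a * y) \<in> borel_measurable M"
    unfolding measurable_cong_sets[OF assms refl] by measurable
  then show ?thesis by (rule measurable_restrict)
qed

lemma perturb_feature_props:
  assumes "\<epsilon> > 0" "\<zeta> > 0" "v \<in> feature_domain K"
  shows "prob_space (perturb_feature K d \<zeta> \<epsilon> v)"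
    and "sets (perturb_feature K d \<zeta> \<epsilon> v) = sets (vec_space (feature_width K))"
proof -
  have "prob_space (perturb_feature K d \<zeta> \<epsilon> v) \<and>
    sets (perturb_feature K d \<zeta> \<epsilon> v) = sets (vec_space (feature_width K))"
  proof (cases K)
    case Numerical
    then have v: "v 0 \<in> {-1..1}" using assms(3) feature_domain_Numerical by blast
    have \<delta>: "\<epsilon> / real \<zeta> > 0" using assms by simp
    note pm = piecewise_mechanism_props(1,2)[OF \<delta> v]
    show ?thesis
      unfolding Numerical perturb_feature.simps perturb_numerical_def feature_width.simps
      using prob_space.prob_space_distr[OF pm(1) measurable_scale_numerical[OF pm(2)]]
      by (intro conjI sets_distr)
  next
    case (Categorical k)
    then show ?thesis
      by (auto simp: perturb_categorical_def intro!: prob_space_PiM sets_PiM_cong)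
  qed
  then show "prob_space (perturb_feature K d \<zeta> \<epsilon> v)"
    and "sets (perturb_feature K d \<zeta> \<epsilon> v) = sets (vec_space (feature_width K))" by auto
qed

text \<open>For a numerical feature, the rescaling by \<open>d / \<zeta>\<close> is post-processing
  of the piecewise mechanism, so both kinds of feature cost the same factor.\<close>

lemma perturb_feature_dp:
  assumes "\<epsilon> > 0" "\<zeta> > 0" "u \<in> feature_domain K" "v \<in> feature_domain K"
  shows "perturb_feature K d \<zeta> \<epsilon> u
    \<le> scale_measure (ennreal (exp (\<epsilon> / real \<zeta>))) (perturb_feature K d \<zeta> \<epsilon> v)"
proof (cases K)
  case Numerical
  then have uv: "u 0 \<in> {-1..1}" "v 0 \<in> {-1..1}"
    using assms(3,4) feature_domain_Numerical by blast+
  have \<delta>: "\<epsilon> / real \<zeta> > 0" using assms by simp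
  note sets = piecewise_mechanism_props(2)[OF \<delta> uv(1)] piecewise_mechanism_props(2)[OF \<delta> uv(2)]
  show ?thesis
    unfolding Numerical perturb_feature.simps perturb_numerical_def
    by (intro distr_le_scale_measure measurable_scale_numerical sets(2) piecewise_mechanism_dp \<delta> uv)
      (simp only: sets)
next
  case (Categorical k)
  then show ?thesis using assms by (simp add: perturb_categorical_dp)
qed

subsection \<open>Concatenation of the blocks\<close>

text \<open>Addresses a flat coordinate by block and position, which reduces statements about a
  concatenation to \<open>nth_concat_blocks\<close>.\<close>

lemma block_offset_decompose:
  assumes "n < block_offset w d"
  obtains i j where "i < d" "j < w i" "n = block_offset w i + j"
proof -
  have "\<exists>i j. i < d \<and> j < w i \<and> n = block_offset w i + j"
    using assms
  proof (induction d)
    case 0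
    then show ?case by (simp add: block_offset_def)
  next
    case (Suc d)
    show ?case
    proof (cases "n < block_offset w d")
      case True
      then show ?thesis using Suc.IH less_Suc_eq by blast
    next
      case False
      then have "n - block_offset w d < w d" "n = block_offset w d + (n - block_offset w d)"
        using Suc.prems by (auto simp: block_offset_def)
      then show ?thesis by blast
    qed
  qed
  then show ?thesis using that by blast
qed

text \<open>Measurability into a product is checked coordinatewise, and each coordinate of the
  concatenation is a fixed coordinate of a fixed block.\<close>

lemma measurable_vec_concat:
  "vec_concat w d \<in> measurable (PiM {..<d} (\<lambda>i. vec_space (w i))) (vec_space (block_offset w d))"
  unfolding vec_concat_def
proof (rule measurable_restrict)
  fix n assume "n \<in> {..<block_offset w d}"
  then obtain i j where ij: "i < d" "j < w i" "n = block_offset w i + j"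
    by (auto elim: block_offset_decompose)
  have "(\<lambda>b. b i) \<in> measurable (PiM {..<d} (\<lambda>i. vec_space (w i))) (vec_space (w i))"
    using ij by (intro measurable_component_singleton) simp
  moreover have "(\<lambda>v. v j) \<in> borel_measurable (vec_space (w i))"
    using ij by (intro measurable_component_singleton) simp
  ultimately have "(\<lambda>b. b i j) \<in> borel_measurable (PiM {..<d} (\<lambda>i. vec_space (w i)))"
    by (rule measurable_compose)
  then show "(\<lambda>b. concat (map (\<lambda>i. map (b i) [0..<w i]) [0..<d]) ! n)
      \<in> borel_measurable (PiM {..<d} (\<lambda>i. vec_space (w i)))"
    using ij by (simp add: nth_concat_blocks)
qed

lemma vec_block_input_domain:
  assumes "x \<in> input_domain F d" "i < d"
  shows "vec_block (widths F) x i \<in> feature_domain (F i)"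
proof -
  obtain b where b: "x = vec_concat (widths F) d b" "\<And>i. i < d \<Longrightarrow> b i \<in> feature_domain (F i)"
    using assms(1) by (auto simp: input_domain_def)
  \<comment> \<open>Extensionality makes the extracted block equal to \<open>b i\<close> as a
    function, not only on the coordinates of the block.\<close>
  have "b i \<in> extensional {..<widths F i}"
    using b(2)[OF assms(2)] by (cases "F i") (auto simp: PiE_def one_hot_def)
  then show ?thesis using b assms(2) by (simp add: vec_block_concat)
qed

subsection \<open>The complete algorithm\<close>

text \<open>Together with \<open>perturb_given\<close>, this names the pieces of
  \<open>perturb_vector\<close> for a fixed sampled set \<open>A\<close>, where the blocks are
  independent.\<close>

definition block_dist ::
  "(nat \<Rightarrow> feature_kind) \<Rightarrow> nat \<Rightarrow> nat \<Rightarrow> real \<Rightarrow> (nat \<Rightarrow> real) \<Rightarrow> nat set \<Rightarrow> nat \<Rightarrow> (nat \<Rightarrow> real) measure"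
  where
  "block_dist F d \<zeta> \<epsilon> x A i =
     (if i \<in> A then perturb_feature (F i) d \<zeta> \<epsilon> (vec_block (widths F) x i)
      else return (vec_space (widths F i)) (\<lambda>j\<in>{..<widths F i}. 0))"

definition perturb_given ::
  "(nat \<Rightarrow> feature_kind) \<Rightarrow> nat \<Rightarrow> nat \<Rightarrow> real \<Rightarrow> (nat \<Rightarrow> real) \<Rightarrow> nat set \<Rightarrow> (nat \<Rightarrow> real) measure"
  where
  "perturb_given F d \<zeta> \<epsilon> x A =
     distr (PiM {..<d} (block_dist F d \<zeta> \<epsilon> x A)) (output_space F d) (vec_concat (widths F) d)"

lemma perturb_vector_eq:
  "perturb_vector F d \<zeta> \<epsilon> x =
     measure_pmf (pmf_of_set {A. A \<subseteq> {..<d} \<and> card A = \<zeta>}) \<bind> perturb_given F d \<zeta> \<epsilon> x"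
  by (simp add: perturb_vector_def perturb_given_def[abs_def] block_dist_def[abs_def])

context
  fixes F :: "nat \<Rightarrow> feature_kind" and d \<zeta> :: nat and \<epsilon> :: real
  assumes eps_pos: "\<epsilon> > 0" and zeta_pos: "\<zeta> > 0"
begin

lemma block_dist_props:
  assumes "x \<in> input_domain F d" "i < d"
  shows "prob_space (block_dist F d \<zeta> \<epsilon> x A i)"
    and "sets (block_dist F d \<zeta> \<epsilon> x A i) = sets (vec_space (widths F i))"
  using perturb_feature_props[OF eps_pos zeta_pos vec_block_input_domain[OF assms]]
  by (auto simp: block_dist_def space_PiM intro!: prob_space_return)

lemma measurable_vec_concat_block_dist:
  assumes "x \<in> input_domain F d"
  shows "vec_concat (widths F) d
    \<in> measurable (PiM {..<d} (block_dist F d \<zeta> \<epsilon> x A)) (output_space F d)"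
proof -
  have "sets (PiM {..<d} (block_dist F d \<zeta> \<epsilon> x A)) = sets (PiM {..<d} (\<lambda>i. vec_space (widths F i)))"
    using block_dist_props(2)[OF assms] by (intro sets_PiM_cong) auto
  then show ?thesis using measurable_vec_concat by (simp cong: measurable_cong_sets)
qed

lemma perturb_given_prob_algebra:
  assumes "x \<in> input_domain F d"
  shows "perturb_given F d \<zeta> \<epsilon> x A \<in> space (prob_algebra (output_space F d))"
  using assms block_dist_props(1) measurable_vec_concat_block_dist
  by (auto simp: space_prob_algebra perturb_given_def
      intro!: prob_space.prob_space_distr prob_space_PiM)

text \<open>A block outside \<open>A\<close> has the same point mass for both inputs and costs a
  factor 1. The \<open>card A = \<zeta>\<close> blocks in \<open>A\<close> together cost
  \<open>exp (\<epsilon> / \<zeta>) ^ \<zeta> = exp \<epsilon>\<close>.\<close>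

lemma perturb_given_dp:
  assumes x: "x \<in> input_domain F d" and y: "y \<in> input_domain F d"
    and A: "A \<subseteq> {..<d}" "card A = \<zeta>"
  shows "perturb_given F d \<zeta> \<epsilon> x A \<le> scale_measure (ennreal (exp \<epsilon>)) (perturb_given F d \<zeta> \<epsilon> y A)"
proof -
  let ?E = "exp (\<epsilon> / real \<zeta>)"
  let ?c = "\<lambda>i. ennreal (if i \<in> A then ?E else 1)"
  have "(\<Prod>i<d. ?c i) = ennreal (\<Prod>i<d. if i \<in> A then ?E else 1)"
    by (rule prod_ennreal) auto
  also have "(\<Prod>i<d. if i \<in> A then ?E else 1) = (\<Prod>i\<in>{..<d} \<inter> A. ?E)"
    by (rule prod.inter_restrict[symmetric]) simp
  also have "\<dots> = exp \<epsilon>"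
    using A zeta_pos by (simp add: Int_absorb1 flip: exp_of_nat_mult)
  finally have c: "(\<Prod>i<d. ?c i) = ennreal (exp \<epsilon>)" .
  have "block_dist F d \<zeta> \<epsilon> x A i \<le> scale_measure (?c i) (block_dist F d \<zeta> \<epsilon> y A i)" if "i < d" for i
    using perturb_feature_dp[OF eps_pos zeta_pos vec_block_input_domain[OF x that]
        vec_block_input_domain[OF y that]]
    by (simp add: block_dist_def)
  then have "PiM {..<d} (block_dist F d \<zeta> \<epsilon> x A)
      \<le> scale_measure (\<Prod>i<d. ?c i) (PiM {..<d} (block_dist F d \<zeta> \<epsilon> y A))"
    using block_dist_props x y by (intro PiM_le_scale_measure) auto
  moreover have "sets (PiM {..<d} (block_dist F d \<zeta> \<epsilon> x A)) = sets (PiM {..<d} (block_dist F d \<zeta> \<epsilon> y A))"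
    using block_dist_props x y by (intro sets_PiM_cong) auto
  ultimately show ?thesis
    unfolding perturb_given_def c by (intro distr_le_scale_measure measurable_vec_concat_block_dist y)
qed

end

theorem lemma4p2:
  fixes \<epsilon> :: real and d \<zeta> :: nat and F :: "nat \<Rightarrow> feature_kind"
  assumes "\<epsilon> > 0" and "d \<ge> 1"
    and "\<zeta> = max 1 (min d (nat \<lfloor>\<epsilon> / 2.5\<rfloor>))"
  shows "local_dp \<epsilon> (input_domain F d) (output_space F d) (perturb_vector F d \<zeta> \<epsilon>)"
proof -
  let ?\<A> = "{A. A \<subseteq> {..<d} \<and> card A = \<zeta>}"
  let ?p = "pmf_of_set ?\<A>"
  let ?N = "output_space F d"
  \<comment> \<open>\<open>\<zeta> \<le> d\<close> makes the family of sampled sets nonempty, so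
    that \<open>pmf_of_set\<close> really is its uniform distribution; \<open>\<zeta> > 0\<close>
    makes the per-feature budget \<open>\<epsilon> / \<zeta>\<close> positive.\<close>
  have \<zeta>: "\<zeta> > 0" "\<zeta> \<le> d" using assms(2,3) by auto
  have "card ?\<A> = d choose \<zeta>" using n_subsets[of "{..<d}" \<zeta>] by simp
  then have "card ?\<A> > 0" using \<zeta> by simp
  then have \<A>: "finite ?\<A>" "?\<A> \<noteq> {}" by (auto simp: card_gt_0_iff)
  \<comment> \<open>Every set is measurable for \<open>measure_pmf\<close>, so only the values of
    the kernel have to be checked.\<close>
  have kernel: "perturb_given F d \<zeta> \<epsilon> x \<in> measurable (measure_pmf ?p) (prob_algebra ?N)"
    if "x \<in> input_domain F d" for x
    using perturb_given_prob_algebra[OF assms(1) \<zeta>(1) that] by simp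
  have props: "prob_space (perturb_vector F d \<zeta> \<epsilon> x)" "sets (perturb_vector F d \<zeta> \<epsilon> x) = sets ?N"
    if "x \<in> input_domain F d" for x
  proof -
    show "prob_space (perturb_vector F d \<zeta> \<epsilon> x)"
      unfolding perturb_vector_eq
      using kernel[OF that] perturb_given_prob_algebra[OF assms(1) \<zeta>(1) that]
      by (intro measure_pmf.prob_space_bind[where S = ?N] measurable_prob_algebraD)
        (auto simp: space_prob_algebra)
    show "sets (perturb_vector F d \<zeta> \<epsilon> x) = sets ?N"
      unfolding perturb_vector_eq using perturb_given_prob_algebra[OF assms(1) \<zeta>(1) that]
      by (intro sets_bind) (auto simp: space_prob_algebra)
  qed
  have em: "emeasure (perturb_vector F d \<zeta> \<epsilon> x) S =
      (\<integral>\<^sup>+A. emeasure (perturb_given F d \<zeta> \<epsilon> x A) S \<partial>measure_pmf ?p)"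
    if "x \<in> input_domain F d" "S \<in> sets ?N" for x S
    unfolding perturb_vector_eq using kernel[OF that(1)] that(2)
    by (intro emeasure_bind[where N = ?N] measurable_prob_algebraD) auto
  have "measure (perturb_vector F d \<zeta> \<epsilon> x) S \<le> exp \<epsilon> * measure (perturb_vector F d \<zeta> \<epsilon> y) S"
    if x: "x \<in> input_domain F d" and y: "y \<in> input_domain F d" and S: "S \<in> sets ?N" for x y S
  proof -
    interpret X: prob_space "perturb_vector F d \<zeta> \<epsilon> x" by (rule props(1)[OF x])
    interpret Y: prob_space "perturb_vector F d \<zeta> \<epsilon> y" by (rule props(1)[OF y])
    have le: "emeasure (perturb_given F d \<zeta> \<epsilon> x A) S
        \<le> ennreal (exp \<epsilon>) * emeasure (perturb_given F d \<zeta> \<epsilon> y A) S" if "A \<in> ?\<A>" for A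
      using perturb_given_dp[OF assms(1) \<zeta>(1) x y, of A] that S
      by (simp add: le_scale_measure_iff perturb_given_def)
    \<comment> \<open>The law of \<open>A\<close> does not depend on the input, so the bound for
      each \<open>A\<close> integrates. That bound is known only for \<open>A\<close> in
      \<open>?\<A>\<close>, which carries all the mass; hence the almost-everywhere form.\<close>
    have "emeasure (perturb_vector F d \<zeta> \<epsilon> x) S
        \<le> (\<integral>\<^sup>+A. ennreal (exp \<epsilon>) * emeasure (perturb_given F d \<zeta> \<epsilon> y A) S \<partial>measure_pmf ?p)"
      unfolding em[OF x S] using le \<A>
      by (intro nn_integral_mono_AE) (simp add: AE_measure_pmf_iff)
    also have "\<dots> = ennreal (exp \<epsilon>) * emeasure (perturb_vector F d \<zeta> \<epsilon> y) S"
      unfolding em[OF y S] by (simp add: nn_integral_cmult)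
    finally show ?thesis
      by (simp add: X.emeasure_eq_measure Y.emeasure_eq_measure ennreal_mult[symmetric])
  qed
  then show ?thesis using props by (simp add: local_dp_def)
qed

end
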